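(* Let $\Psi:{}^{\omega>}2\to\omega$ be any function. Define $\Psi^*:{}^{\omega>}2\to{}^{\omega>}\omega$ by induction: $\Psi^*(\langle\rangle)=\langle\rangle$ and $\Psi^*(t^\frown\langle i\rangle)=\Psi^*(t)^\frown\langle\Psi(t^\frown\langle i\rangle)\rangle$ for $t\in{}^{\omega>}2$, $i\in 2$. For a partial function $\xi$ from $\omega$ to $2$ let \[W(\xi)=\{t\in{}^m2: m<\omega\ \&\ \xi\restriction m\subseteq t\}\] and $T(\xi)=\{\Psi^*(t):t\in W(\xi)\}$. Then there is a partial function $\xi:\omega\to 2$ whose domain is co-infinite (i.e. $\omega\setminus\mathrm{Dom}(\xi)$ is infinite) such that $T(\xi)$ is a binary tree, i.e. every $\nu\in T(\xi)$ has at most $2$ immediate successors in $T(\xi)$.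
   Context: ${}^{\omega>}2$ denotes the set of finite sequences of elements of $\{0,1\}$ and ${}^{\omega>}\omega$ the set of finite sequences of natural numbers; $^\frown$ denotes concatenation. For a partial function $\xi$ from $\omega$, $\xi\restriction m$ is its restriction to $m=\{0,\dots,m-1\}$, and $\xi\restriction m\subseteq t$ means $t(k)=\xi(k)$ for all $k<m$ in the domain of $\xi$. An immediate successor of $\nu$ in a tree $T$ (a set of finite sequences closed under initial segments) is a $\rho\in T$ properly extending $\nu$ such that no element of $T$ lies strictly between $\nu$ and $\rho$. *)

theory Defs
  imports Main "HOL-Library.Sublist"
begin

text \<open>The two-element set \<open>2 = {0, 1}\<close> is the type \<^typ>\<open>bool\<close>, and a finite sequence
  \<open>t\<close> is a list whose value at \<open>k < length t\<close> is \<open>t ! k\<close>.\<close>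

function Psi_star :: "(bool list \<Rightarrow> nat) \<Rightarrow> bool list \<Rightarrow> nat list" where
  "Psi_star \<Psi> [] = []"
| "Psi_star \<Psi> (t @ [i]) = Psi_star \<Psi> t @ [\<Psi> (t @ [i])]"
  by (auto, metis rev_exhaust)
termination
  by (relation "measure (\<lambda>(\<Psi>, t). length t)") auto

definition W :: "(nat \<rightharpoonup> bool) \<Rightarrow> bool list set" where
  "W \<xi> = {t. \<forall>k < length t. k \<in> dom \<xi> \<longrightarrow> \<xi> k = Some (t ! k)}"

definition T :: "(bool list \<Rightarrow> nat) \<Rightarrow> (nat \<rightharpoonup> bool) \<Rightarrow> nat list set" where
  "T \<Psi> \<xi> = Psi_star \<Psi> ` W \<xi>"

definition is_tree :: "'a list set \<Rightarrow> bool" where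
  "is_tree S \<longleftrightarrow> (\<forall>\<rho> \<in> S. \<forall>\<nu>. prefix \<nu> \<rho> \<longrightarrow> \<nu> \<in> S)"

definition immediate_successors :: "'a list set \<Rightarrow> 'a list \<Rightarrow> 'a list set" where
  "immediate_successors S \<nu> =
    {\<rho> \<in> S. strict_prefix \<nu> \<rho> \<and> \<not> (\<exists>\<sigma> \<in> S. strict_prefix \<nu> \<sigma> \<and> strict_prefix \<sigma> \<rho>)}"

text \<open>Finiteness is stated explicitly because \<^const>\<open>card\<close> is 0 on infinite sets.\<close>

definition binary_tree :: "'a list set \<Rightarrow> bool" where
  "binary_tree S \<longleftrightarrow> is_tree S \<and>
    (\<forall>\<nu> \<in> S. finite (immediate_successors S \<nu>) \<and> card (immediate_successors S \<nu>) \<le> 2)"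

end

theory Submission
  imports Defs
begin

text \<open>Build \<open>\<xi>\<close> by finite approximations, maintaining the invariant that any two sequences compatible
  with the current approximation which have the same image under \<open>\<Psi>\<^sup>*\<close> keep equal images after
  appending any common tail. Then leave the next coordinate free. Above a node \<open>\<nu>\<close> only the
  value at that one free coordinate matters, so \<open>\<nu>\<close> has at most two successors, however the
  following coordinates are fixed. Fixing them so as to separate as many pairs as
  possible restores the invariant.\<close>

lemma length_Psi_star [simp]: "length (Psi_star \<Psi> t) = length t"
  by (induction t rule: rev_induct) simp_all

lemma take_Psi_star: "take k (Psi_star \<Psi> t) = Psi_star \<Psi> (take k t)"
proof (induction t rule: rev_induct)
  case (snoc i t)
  then show ?case
    by (cases "k \<le> length t") simp_all
qed simp

lemma Psi_star_append_eqD: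
  assumes "Psi_star \<Psi> (s @ u) = Psi_star \<Psi> (t @ v)" "length s = length t"
  shows "Psi_star \<Psi> s = Psi_star \<Psi> t"
  using arg_cong[OF assms(1), of "take (length s)"] assms(2) by (simp add: take_Psi_star)

definition inseparable :: "(bool list \<Rightarrow> nat) \<Rightarrow> bool list set \<Rightarrow> bool" where
  "inseparable \<Psi> S \<longleftrightarrow>
    (\<forall>s\<in>S. \<forall>t\<in>S. Psi_star \<Psi> s = Psi_star \<Psi> t \<longrightarrow>
      (\<forall>v. Psi_star \<Psi> (s @ v) = Psi_star \<Psi> (t @ v)))"

text \<open>Choose \<open>u\<close> to minimise the number of pairs in \<open>S\<close> whose images
  still agree after appending \<open>u\<close>. As all members of \<open>S\<close> have the same
  length, a longer tail can only separate more pairs; by minimality it separates none, so agreement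
  after \<open>u\<close> persists under every further tail.\<close>

lemma ex_inseparable_extension:
  assumes "finite S" and len: "\<And>t. t \<in> S \<Longrightarrow> length t = n"
  shows "\<exists>u. inseparable \<Psi> ((\<lambda>t. t @ u) ` S)"
proof -
  define P where "P u = {(s, t) \<in> S \<times> S. Psi_star \<Psi> (s @ u) = Psi_star \<Psi> (t @ u)}" for u
  have fin: "finite (P u)" for u
    using finite_subset[of "P u" "S \<times> S"] \<open>finite S\<close> by (auto simp: P_def)
  obtain u where u: "\<And>v. card (P u) \<le> card (P v)"
    using ex_has_least_nat[of "\<lambda>_. True" _ "\<lambda>u. card (P u)"] by auto
  have "P (u @ v) \<subseteq> P u" for v
    unfolding P_def using len
    by (auto dest!: Psi_star_append_eqD[of \<Psi> "_ @ u" v "_ @ u" v, simplified])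
  then have "P (u @ v) = P u" for v
    using card_seteq[OF fin] u by blast
  then show ?thesis
    unfolding inseparable_def P_def by (intro exI[of _ u]) (auto simp: set_eq_iff)
qed

text \<open>A finite approximation to \<open>\<xi>\<close> is a list in which \<^term>\<open>None\<close> marks a free coordinate.\<close>

definition compatible :: "bool option list \<Rightarrow> bool list set" where
  "compatible p = {t. list_all2 (\<lambda>x b. x = None \<or> x = Some b) p t}"

lemma length_compatible: "t \<in> compatible p \<Longrightarrow> length t = length p"
  by (auto simp: compatible_def dest: list_all2_lengthD)

lemma finite_compatible: "finite (compatible p)"
  by (rule finite_subset[OF _ finite_lists_length_eq[of "UNIV :: bool set" "length p"]])
    (auto simp: length_compatible)

lemma compatible_map_Some: "compatible (map Some u) = {u}"
  by (auto simp: compatible_def list_all2_map1 list.rel_eq)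

lemma compatible_append:
  "compatible (p @ q) = {s @ t |s t. s \<in> compatible p \<and> t \<in> compatible q}"
  unfolding compatible_def by (auto intro: list_all2_appendI) (auto simp: list_all2_append1)

lemma compatible_free_fixed:
  "compatible (p @ None # map Some u) = {s @ b # u |s b. s \<in> compatible p}"
proof -
  have "compatible (None # map Some u) = {b # u |b. True}"
    using compatible_map_Some[of u] by (auto simp: compatible_def list_all2_Cons1)
  then show ?thesis
    by (auto simp: compatible_append)
qed

text \<open>The free coordinate comes before the block \<open>u\<close>, so the choice of
  \<open>u\<close> already takes both values at that coordinate into account.\<close>

lemma ex_inseparable_free_fixed:
  "\<exists>u. inseparable \<Psi> (compatible (p @ None # map Some u))"
proof -
  obtain u where "inseparable \<Psi> ((\<lambda>t. t @ u) ` compatible (p @ [None]))"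
    using ex_inseparable_extension[OF finite_compatible length_compatible] by blast
  moreover have "(\<lambda>t. t @ u) ` compatible (p @ [None]) = compatible (p @ None # map Some u)"
    using compatible_append[of "p @ [None]" "map Some u"] by (auto simp: compatible_map_Some)
  ultimately show ?thesis
    by metis
qed

lemma ex_approximations:
  "\<exists>p u. p 0 = [] \<and> (\<forall>j. inseparable \<Psi> (compatible (p j)) \<and> p (Suc j) = p j @ None # map Some (u j))"
proof -
  \<comment> \<open>The clause for \<open>j = 0\<close> pins the start of the dependent choice.
    There the invariant is trivial, since only the empty sequence is compatible with
    \<open>[]\<close>.\<close>
  have "\<exists>p. \<forall>j. (inseparable \<Psi> (compatible (p j)) \<and> (j = 0 \<longrightarrow> p j = [])) \<and>
      (\<exists>u. p (Suc j) = p j @ None # map Some u)"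
  proof (rule dependent_nat_choice)
    show "\<exists>q. inseparable \<Psi> (compatible q) \<and> (0 = 0 \<longrightarrow> q = [])"
      by (simp add: inseparable_def compatible_def)
  next
    fix q and j :: nat
    show "\<exists>q'. (inseparable \<Psi> (compatible q') \<and> (Suc j = 0 \<longrightarrow> q' = [])) \<and>
        (\<exists>u. q' = q @ None # map Some u)"
      using ex_inseparable_free_fixed[of \<Psi> q] by auto
  qed
  then obtain p where p: "\<And>j. inseparable \<Psi> (compatible (p j))" "p 0 = []"
      "\<And>j. \<exists>u. p (Suc j) = p j @ None # map Some u"
    by blast
  from p(3) obtain u where "\<And>j. p (Suc j) = p j @ None # map Some (u j)"
    by metis
  with p(1,2) show ?thesis
    by blast
qed

lemma take_in_W: "t \<in> W \<xi> \<Longrightarrow> take k t \<in> W \<xi>"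
  by (auto simp: W_def)

lemma is_tree_T: "is_tree (T \<Psi> \<xi>)"
  unfolding is_tree_def
proof safe
  fix \<rho> \<nu>
  assume "\<rho> \<in> T \<Psi> \<xi>" "prefix \<nu> \<rho>"
  then obtain t where "t \<in> W \<xi>" "\<nu> = Psi_star \<Psi> (take (length \<nu>) t)"
    by (auto simp: T_def prefix_def simp flip: take_Psi_star)
  then show "\<nu> \<in> T \<Psi> \<xi>"
    using take_in_W unfolding T_def by blast
qed

text \<open>In a tree the initial segment of \<open>\<rho>\<close> one entry longer than
  \<open>\<nu>\<close> is itself a node, so it would lie strictly between if \<open>\<rho>\<close>
  were longer.\<close>

lemma immediate_successor_length:
  assumes "is_tree S" "\<rho> \<in> immediate_successors S \<nu>"
  shows "length \<rho> = Suc (length \<nu>)"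
proof (rule ccontr)
  assume neq: "length \<rho> \<noteq> Suc (length \<nu>)"
  from assms(2) have \<rho>: "\<rho> \<in> S" "strict_prefix \<nu> \<rho>"
    and least: "\<And>\<sigma>. \<sigma> \<in> S \<Longrightarrow> strict_prefix \<nu> \<sigma> \<Longrightarrow> \<not> strict_prefix \<sigma> \<rho>"
    by (auto simp: immediate_successors_def)
  from \<rho>(2) obtain x xs where xs: "\<rho> = \<nu> @ x # xs"
    by (rule strict_prefixE')
  with neq have "strict_prefix (\<nu> @ [x]) \<rho>"
    by (auto simp: strict_prefix_def)
  moreover from this have "\<nu> @ [x] \<in> S"
    using assms(1) \<rho>(1) unfolding is_tree_def by (meson prefix_order.less_imp_le)
  ultimately show False
    using least[of "\<nu> @ [x]"] by (simp add: strict_prefix_def)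
qed

theorem theorem1p2:
  fixes \<Psi> :: "bool list \<Rightarrow> nat"
  shows "\<exists>\<xi> :: nat \<rightharpoonup> bool. infinite (UNIV - dom \<xi>) \<and> binary_tree (T \<Psi> \<xi>)"
proof -
  obtain p u where p0: "p 0 = []" and insep: "\<And>j. inseparable \<Psi> (compatible (p j))"
    and p_Suc: "\<And>j. p (Suc j) = p j @ None # map Some (u j)"
    using ex_approximations[of \<Psi>] by blast
  define l where "l j = length (p j)" for j
  \<comment> \<open>The index is in range because \<open>p (Suc k)\<close> has length at least
    \<open>Suc k\<close>; any other approximation long enough gives the same value.\<close>
  define \<xi> where "\<xi> k = p (Suc k) ! k" for k
  have l_mono: "strict_mono l"
    by (auto simp: strict_mono_Suc_iff l_def p_Suc)
  have le_l: "j \<le> l j" for j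
    using strict_mono_imp_increasing[OF l_mono] .
  have p_mono: "prefix (p i) (p j)" if "i \<le> j" for i j
    using that by (induction j rule: dec_induct) (auto simp: p_Suc intro: prefix_order.trans)
  have p_nth: "p j ! k = \<xi> k" if "k < l j" for j k
  proof -
    have "k < l (Suc k)"
      using le_l[of "Suc k"] by simp
    with that show ?thesis
      using p_mono[of j "Suc k"] p_mono[of "Suc k" j] unfolding \<xi>_def l_def
      by (cases "j \<le> Suc k") (auto simp: prefix_def nth_append)
  qed
  have compat: "t \<in> compatible (take (length t) (p j))" if "t \<in> W \<xi>" "length t \<le> l j" for t j
    using that p_nth[of _ j] unfolding W_def compatible_def l_def
    by (auto simp: list_all2_conv_all_nth dom_def)
  \<comment> \<open>Each stage puts its free coordinate right after the previous approximation,
    hence at position \<open>l j\<close>.\<close>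
  have "\<xi> (l j) = None" for j
    using p_nth[of "l j" "Suc j"] by (simp add: l_def p_Suc)
  then have "range l \<subseteq> UNIV - dom \<xi>"
    by auto
  then have "infinite (UNIV - dom \<xi>)"
    using finite_imageD[OF _ strict_mono_imp_inj_on[OF l_mono]] finite_subset infinite_UNIV_nat by blast
  moreover have "finite I \<and> card I \<le> 2"
    if I_eq: "I = immediate_successors (T \<Psi> \<xi>) \<nu>" and \<nu>: "\<nu> \<in> T \<Psi> \<xi>" for \<nu> I
  proof -
    define n where "n = length \<nu>"
    \<comment> \<open>The least such \<open>j\<close> gives \<open>l j \<le> n < l (Suc j)\<close>,
      so the only free coordinate from \<open>l j\<close> up to \<open>n\<close> is
      \<open>l j\<close> itself.\<close>
    have "\<exists>j. n < l (Suc j)"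
      using le_l[of "Suc n"] by (intro exI[of _ n]) simp
    then obtain j where j: "n < l (Suc j)" "\<And>i. i < j \<Longrightarrow> l (Suc i) \<le> n"
      using exists_least_iff[of "\<lambda>j. n < l (Suc j)"] by (auto simp: not_less)
    have lj: "l j \<le> n"
      using j(2)[of "j - 1"] p0 by (cases j) (auto simp: l_def)
    \<comment> \<open>The values that \<open>\<xi>\<close> forces at the coordinates after
      \<open>l j\<close> up to and including \<open>n\<close>.\<close>
    define w where "w = take (n - l j) (u j)"
    obtain t where t: "t \<in> W \<xi>" "\<nu> = Psi_star \<Psi> t"
      using \<nu> by (auto simp: T_def)
    define a where "a = take (l j) t"
    have len_t: "length t = n"
      by (simp add: n_def t)
    have a: "a \<in> compatible (p j)"
      using compat[of a j] t(1) len_t lj by (simp add: a_def take_in_W l_def)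
    \<comment> \<open>The segment \<open>a\<close> comes from one fixed preimage \<open>t\<close> of
      \<open>\<nu>\<close>, so \<open>\<rho>\<close> depends only on the bit
      \<open>b\<close>.\<close>
    have "\<rho> \<in> (\<lambda>b. Psi_star \<Psi> (a @ b # w)) ` UNIV" if \<rho>: "\<rho> \<in> I" for \<rho>
    proof -
      have len_\<rho>: "length \<rho> = Suc n"
        using immediate_successor_length[OF is_tree_T] \<rho> I_eq n_def by blast
      have "prefix \<nu> \<rho>"
        using \<rho> I_eq by (auto simp: immediate_successors_def strict_prefix_def)
      then have take_\<rho>: "take n \<rho> = \<nu>"
        by (auto simp: prefix_def n_def)
      obtain r where r: "r \<in> W \<xi>" "\<rho> = Psi_star \<Psi> r"
        using \<rho> I_eq by (auto simp: immediate_successors_def T_def)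
      have len_r: "length r = Suc n"
        using len_\<rho> r by simp
      then have "r \<in> compatible (take (Suc n) (p (Suc j)))"
        using compat[OF r(1), of "Suc j"] j(1) by simp
      also have "take (Suc n) (p (Suc j)) = p j @ None # map Some w"
        using lj by (simp add: p_Suc l_def w_def take_map Suc_diff_le)
      finally obtain s b where s: "r = s @ b # w" "s \<in> compatible (p j)"
        by (auto simp: compatible_free_fixed)
      \<comment> \<open>Both \<open>s\<close> and \<open>a\<close> map to the initial segment of
        \<open>\<nu>\<close> of length \<open>l j\<close>, so the invariant for \<open>p j\<close>
        allows \<open>s\<close> to be replaced by \<open>a\<close> before the tail
        \<open>b # w\<close>.\<close>
      have "Psi_star \<Psi> s = take (l j) \<rho>"
        using s length_compatible[OF s(2)] by (simp add: r(2) take_Psi_star l_def)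
      also have "\<dots> = take (l j) \<nu>"
        using lj by (simp add: min_def flip: take_\<rho>)
      also have "\<dots> = Psi_star \<Psi> a"
        by (simp add: a_def t(2) take_Psi_star)
      finally have "\<rho> = Psi_star \<Psi> (a @ b # w)"
        using insep[of j] s a r(2) unfolding inseparable_def by blast
      then show ?thesis
        by blast
    qed
    then have sub: "I \<subseteq> (\<lambda>b. Psi_star \<Psi> (a @ b # w)) ` UNIV"
      by blast
    have "card I \<le> card (UNIV :: bool set)"
      using card_mono[OF _ sub] card_image_le[of "UNIV :: bool set" "\<lambda>b. Psi_star \<Psi> (a @ b # w)"]
      by simp
    then show ?thesis
      using finite_subset[OF sub] by simp
  qed
  ultimately show ?thesis
    using is_tree_T unfolding binary_tree_def by blast
qed

end
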